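(* Suppose $\preceq$ is a qualitative probability order on $2^{[n]}$ and $T\in2^{[n]}$. Then the initial segment $\Delta(\preceq,T)=\{X\subseteq[n]\mid X\prec T\}$ is strongly acyclic.
   Context: $n$ is a positive integer and $[n]=\{1,\dots,n\}$. An order is a reflexive, complete and transitive binary relation. A qualitative probability order on $[n]$ (on $2^{[n]}$) is an order $\preceq$ on $2^{[n]}$ such that (1) $\emptyset\preceq A$ for every nonempty $A\subseteq[n]$, and (2) for all $A,B,C\subseteq[n]$ with $(A\cup B)\cap C=\emptyset$: $A\preceq B\iff A\cup C\preceq B\cup C$. $X\prec Y$ means $X\preceq Y$ but not $Y\preceq X$. An initial segment is a simplicial complex, i.e. a family closed under taking subsets. For a simplicial complex $\Delta\subseteq2^{[n]}$, the Winder desirability relation $\le_W$ on $2^{[n]}$ is: $A\le_WB$ iff for every $Z\subseteq[n]\setminus((A\setminus B)\cup(B\setminus A))$, $(A\setminus B)\cup Z\notin\Delta$ implies $(B\setminus A)\cup Z\notin\Delta$. The Winder existential ordering $\prec_W$ is: $A\prec_WB$ iff it is not the case that $B\le_WA$. $\Delta$ is strongly acyclic if for no $k$ are there sets $A_1,\dots,A_k\subseteq[n]$ with $A_1\prec_WA_2\prec_W\cdots\prec_WA_k\prec_WA_1$. *)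

theory Defs
  imports Main
begin

text \<open>
  Relations on the subsets of \<open>{1..n}\<close> are binary predicates on \<open>nat set\<close>; only their values on
  \<open>Pow {1..n}\<close> matter.
\<close>

definition qual_prob_order :: "nat \<Rightarrow> (nat set \<Rightarrow> nat set \<Rightarrow> bool) \<Rightarrow> bool" where
  "qual_prob_order n le \<longleftrightarrow>
     reflp_on (Pow {1..n}) le \<and> totalp_on (Pow {1..n}) le \<and> transp_on (Pow {1..n}) le \<and>
     (\<forall>A. A \<subseteq> {1..n} \<and> A \<noteq> {} \<longrightarrow> le {} A) \<and>
     (\<forall>A B C. A \<subseteq> {1..n} \<and> B \<subseteq> {1..n} \<and> C \<subseteq> {1..n} \<and> (A \<union> B) \<inter> C = {} \<longrightarrow>
        (le A B \<longleftrightarrow> le (A \<union> C) (B \<union> C)))"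

definition strict_part :: "('a \<Rightarrow> 'a \<Rightarrow> bool) \<Rightarrow> 'a \<Rightarrow> 'a \<Rightarrow> bool" where
  "strict_part le X Y \<longleftrightarrow> le X Y \<and> \<not> le Y X"

text \<open>The empty family counts as a simplicial complex.\<close>

definition simplicial_complex :: "nat \<Rightarrow> nat set set \<Rightarrow> bool" where
  "simplicial_complex n \<Delta> \<longleftrightarrow> \<Delta> \<subseteq> Pow {1..n} \<and> (\<forall>X\<in>\<Delta>. \<forall>Y. Y \<subseteq> X \<longrightarrow> Y \<in> \<Delta>)"

definition initial_segment :: "nat \<Rightarrow> (nat set \<Rightarrow> nat set \<Rightarrow> bool) \<Rightarrow> nat set \<Rightarrow> nat set set" where
  "initial_segment n le T = {X. X \<subseteq> {1..n} \<and> strict_part le X T}"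

definition winder_le :: "nat \<Rightarrow> nat set set \<Rightarrow> nat set \<Rightarrow> nat set \<Rightarrow> bool" where
  "winder_le n \<Delta> A B \<longleftrightarrow>
     (\<forall>Z. Z \<subseteq> {1..n} - ((A - B) \<union> (B - A)) \<longrightarrow>
        (A - B) \<union> Z \<notin> \<Delta> \<longrightarrow> (B - A) \<union> Z \<notin> \<Delta>)"

text \<open>The existential ordering is the negated converse of \<open>winder_le\<close>, not its strict part.\<close>

definition winder_less :: "nat \<Rightarrow> nat set set \<Rightarrow> nat set \<Rightarrow> nat set \<Rightarrow> bool" where
  "winder_less n \<Delta> A B \<longleftrightarrow> \<not> winder_le n \<Delta> B A"

definition strongly_acyclic :: "nat \<Rightarrow> nat set set \<Rightarrow> bool" where
  "strongly_acyclic n \<Delta> \<longleftrightarrow>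
     \<not> (\<exists>k\<ge>1. \<exists>A :: nat \<Rightarrow> nat set.
          (\<forall>i\<in>{1..k}. A i \<subseteq> {1..n}) \<and>
          (\<forall>i\<in>{1..<k}. winder_less n \<Delta> (A i) (A (Suc i))) \<and>
          winder_less n \<Delta> (A k) (A 1))"

text \<open>
  The Winder relations and strong acyclicity are only considered for simplicial complexes; the following
  shows that they apply to \<open>initial_segment\<close>.
\<close>

lemma simplicial_complex_initial_segment:
  assumes q: "qual_prob_order n le" and T: "T \<subseteq> {1..n}"
  shows "simplicial_complex n (initial_segment n le T)"
  unfolding simplicial_complex_def
proof (intro conjI ballI allI impI)
  show "initial_segment n le T \<subseteq> Pow {1..n}"
    by (auto simp: initial_segment_def)
next
  fix X Y assume X: "X \<in> initial_segment n le T" and YX: "Y \<subseteq> X"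
  have Xn: "X \<subseteq> {1..n}" and XT: "le X T" "\<not> le T X"
    using X by (auto simp: initial_segment_def strict_part_def)
  have Yn: "Y \<subseteq> {1..n}" using YX Xn by blast
  have rfl: "reflp_on (Pow {1..n}) le" and trp: "transp_on (Pow {1..n}) le"
    and emp: "\<forall>A. A \<subseteq> {1..n} \<and> A \<noteq> {} \<longrightarrow> le {} A"
    and add: "\<forall>A B C. A \<subseteq> {1..n} \<and> B \<subseteq> {1..n} \<and> C \<subseteq> {1..n} \<and> (A \<union> B) \<inter> C = {} \<longrightarrow>
        (le A B \<longleftrightarrow> le (A \<union> C) (B \<union> C))"
    using q unfolding qual_prob_order_def by - (elim conjE, assumption)+
  have Dn: "X - Y \<subseteq> {1..n}" using Xn by blast
  have "le {} (X - Y)"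
  proof (cases "X - Y = {}")
    case True
    then show ?thesis using reflp_onD[OF rfl, of "{}"] by (simp only: Pow_bottom)
  next
    case False
    then show ?thesis using emp[rule_format, of "X - Y"] Dn by simp
  qed
  moreover have "({} \<union> (X - Y)) \<inter> Y = {}" by blast
  ultimately have "le ({} \<union> Y) ((X - Y) \<union> Y)"
    using add[rule_format, of "{}" "X - Y" Y] Dn Yn by simp
  moreover have "(X - Y) \<union> Y = X" using YX by blast
  ultimately have "le Y X" by (simp only: Un_empty_left)
  have "le Y T"
    using transp_onD[OF trp, of Y X T] \<open>le Y X\<close> XT(1) Xn Yn T by simp
  moreover have "\<not> le T Y"
    using transp_onD[OF trp, of T Y X] \<open>le Y X\<close> XT(2) Xn Yn T by auto
  ultimately show "Y \<in> initial_segment n le T"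
    using Yn by (simp add: initial_segment_def strict_part_def)
qed

end

theory Submission
  imports Defs
begin

text \<open>
  If \<open>A\<close> strictly precedes \<open>B\<close> in the Winder existential ordering of an initial segment with
  threshold \<open>T\<close>, a witness \<open>Z\<close> gives \<open>(A - B) \<union> Z \<prec> T \<preceq> (B - A) \<union> Z\<close>. Cancelling \<open>Z\<close> and then
  adding \<open>A \<inter> B\<close> on both sides yields \<open>A \<prec> B\<close>, and the strict part of a transitive relation has
  no cycles.
\<close>

lemma qual_prob_order_trans:
  assumes "qual_prob_order n le" "A \<subseteq> {1..n}" "B \<subseteq> {1..n}" "C \<subseteq> {1..n}" "le A B" "le B C"
  shows "le A C"
  using assms unfolding qual_prob_order_def by (auto dest: transp_onD[of _ _ A B C])

text \<open>\<open>totalp_on\<close> compares only distinct sets, so reflexivity has to supply the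
  case \<open>A = B\<close>.\<close>

lemma qual_prob_order_total:
  assumes "qual_prob_order n le" "A \<subseteq> {1..n}" "B \<subseteq> {1..n}"
  shows "le A B \<or> le B A"
  using assms unfolding qual_prob_order_def
  by (cases "A = B") (auto dest: reflp_onD[of _ _ A] totalp_onD[of _ _ A B])

text \<open>Additivity is an equivalence, so it also transfers the negated half of
  \<open>strict_part\<close>, with \<open>A\<close> and \<open>B\<close> swapped.\<close>

lemma strict_part_Un_iff:
  assumes "qual_prob_order n le" "A \<subseteq> {1..n}" "B \<subseteq> {1..n}" "C \<subseteq> {1..n}" "(A \<union> B) \<inter> C = {}"
  shows "strict_part le (A \<union> C) (B \<union> C) \<longleftrightarrow> strict_part le A B"
proof -
  have "\<forall>A B C. A \<subseteq> {1..n} \<and> B \<subseteq> {1..n} \<and> C \<subseteq> {1..n} \<and> (A \<union> B) \<inter> C = {} \<longrightarrow>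
      (le A B \<longleftrightarrow> le (A \<union> C) (B \<union> C))"
    using assms(1) unfolding qual_prob_order_def by (elim conjE)
  from this[rule_format, of A B C] this[rule_format, of B A C] show ?thesis
    using assms(2-) unfolding strict_part_def by (simp add: Un_commute)
qed

lemma winder_less_initial_segment_imp_strict_part:
  assumes q: "qual_prob_order n le" and T: "T \<subseteq> {1..n}" and A: "A \<subseteq> {1..n}" and B: "B \<subseteq> {1..n}"
    and less: "winder_less n (initial_segment n le T) A B"
  shows "strict_part le A B"
proof -
  obtain Z where Z: "Z \<subseteq> {1..n} - ((B - A) \<union> (A - B))"
    and notin: "(B - A) \<union> Z \<notin> initial_segment n le T"
    and mem: "(A - B) \<union> Z \<in> initial_segment n le T"
    using less unfolding winder_less_def winder_le_def by blast
  have sub: "A - B \<subseteq> {1..n}" "B - A \<subseteq> {1..n}" "Z \<subseteq> {1..n}" "A \<inter> B \<subseteq> {1..n}"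
    "(A - B) \<union> Z \<subseteq> {1..n}" "(B - A) \<union> Z \<subseteq> {1..n}"
    using A B Z by auto
  have below: "strict_part le ((A - B) \<union> Z) T"
    using mem by (simp add: initial_segment_def)
  \<comment> \<open>Lying outside the segment only denies being strictly below \<open>T\<close>;
    totality turns this into a comparison.\<close>
  have above: "le T ((B - A) \<union> Z)"
    using notin sub(6) qual_prob_order_total[OF q sub(6) T]
    by (auto simp: initial_segment_def strict_part_def)
  have "strict_part le ((A - B) \<union> Z) ((B - A) \<union> Z)"
    using below above qual_prob_order_trans[OF q sub(5) T sub(6)]
      qual_prob_order_trans[OF q T sub(6) sub(5)]
    unfolding strict_part_def by blast
  \<comment> \<open>\<open>Z\<close> avoids the symmetric difference but may meet
    \<open>A \<inter> B\<close>, so it is cancelled before the common part is put back.\<close>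
  then have "strict_part le (A - B) (B - A)"
    using strict_part_Un_iff[OF q sub(1-3)] Z by blast
  then have "strict_part le ((A - B) \<union> (A \<inter> B)) ((B - A) \<union> (A \<inter> B))"
    using strict_part_Un_iff[OF q sub(1,2,4)] by blast
  moreover have "(A - B) \<union> (A \<inter> B) = A" "(B - A) \<union> (A \<inter> B) = B"
    by auto
  ultimately show ?thesis by simp
qed

theorem theorem8:
  fixes n :: nat and le :: "nat set \<Rightarrow> nat set \<Rightarrow> bool" and T :: "nat set"
  assumes "n \<ge> 1"
    and "qual_prob_order n le"
    and "T \<in> Pow {1..n}"
  shows "strongly_acyclic n (initial_segment n le T)"
  unfolding strongly_acyclic_def
proof (intro notI, elim exE conjE)
  fix k :: nat and A :: "nat \<Rightarrow> nat set"
  let ?less = "winder_less n (initial_segment n le T)"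
  assume k: "k \<ge> 1" and sub: "\<forall>i\<in>{1..k}. A i \<subseteq> {1..n}"
    and chain: "\<forall>i\<in>{1..<k}. ?less (A i) (A (Suc i))" and last: "?less (A k) (A 1)"
  note q = assms(2)
  have T: "T \<subseteq> {1..n}" using assms(3) by simp
  note strict = winder_less_initial_segment_imp_strict_part[OF q T]
  have A1: "A 1 \<subseteq> {1..n}" and Ak: "A k \<subseteq> {1..n}" using sub k by auto
  \<comment> \<open>A weak comparison suffices along the chain, and it also covers
    \<open>k = 1\<close>, where the cycle is a single loop at \<open>A 1\<close>.\<close>
  have "le (A 1) (A i)" if "1 \<le> i" "i \<le> k" for i
    using that
  proof (induction i rule: dec_induct)
    case base
    show ?case using qual_prob_order_total[OF q A1 A1] by simp
  next
    case (step i)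
    then have Ai: "A i \<subseteq> {1..n}" and ASi: "A (Suc i) \<subseteq> {1..n}" using sub by auto
    have "?less (A i) (A (Suc i))" using chain step by simp
    then have "le (A i) (A (Suc i))"
      using strict[OF Ai ASi] by (simp add: strict_part_def)
    then show ?case
      using qual_prob_order_trans[OF q A1 Ai ASi] step by simp
  qed
  then have "le (A 1) (A k)" using k by simp
  \<comment> \<open>The closing link of the cycle supplies the strictness.\<close>
  moreover have "\<not> le (A 1) (A k)"
    using strict[OF Ak A1 last] by (simp add: strict_part_def)
  ultimately show False by contradiction
qed

end
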